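(* Assume $s>2c$. Let $g^*$ be the flip attack. Then for every admissible detection strategy $f$, $$\gamma(f,g^* )\le (s-2c)\,I,$$ where $I=\min\{I_0,I_1\}$.
   Context: A binary state $\theta\in\{0,1\}$ is observed by $s$ sensors indexed by $\mathcal{S}=\{1,\dots,s\}$; at each time $k\in\mathbb{Z}^+$ sensor $i$ produces a real observation $x_i(k)$. Let $\mu,\nu$ be mutually absolutely continuous Borel probability measures on $\mathbb{R}$. Under $\mathbb{P}_\theta$ all $x_i(k)$ are independent, with law $\nu$ if $\theta=0$ and $\mu$ if $\theta=1$. Let $I_1=\int\log\frac{d\mu}{d\nu}\,d\mu$, $I_0=-\int\log\frac{d\mu}{d\nu}\,d\nu$, assumed $0<I_0,I_1<\infty$, and $I=\min\{I_0,I_1\}$. Attack model: an attacker compromises a fixed set $\mathcal{C}\subseteq\mathcal{S}$ with $|\mathcal{C}|=c$ (the detector knows $c$ but not $\mathcal{C}$). The fusion center receives $x'(k)=x(k)+x^a(k)$, where $x^a(k)\in\mathbb{R}^s$, the union over $k$ of the supports of $x^a(k)$ equals $\mathcal{C}$, and $x^a(k)=g(X_{\mathcal{C}}(k),X^a(k-1),\theta,k)$ is a measurable (possibly randomized) function of the true observations of the compromised sensors up to time $k$, the previously injected vectors, the true state $\theta$, and $k$. Such $g$ is an admissible attack; $\mathbb{P}^g_\theta,\mathbb{E}^g_\theta$ denote probability and expectation of the manipulated observations. A detection strategy is a sequence $f=(f_1,f_2,\dots)$ where $f_k$ maps the manipulated observations $x'(1),\dots,x'(k)$ to $\{\text{continue},0,1\}$;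 its stopping time $T$ is the first $k$ with $f_k\neq\text{continue}$, decision $f_T$. With $\alpha=\mathbb{P}^g_0[f_T=1]$, $\beta=\mathbb{P}^g_1[f_T=0]$, $D(T)=\max_\theta\mathbb{E}^g_\theta[T]$, the performance is $\gamma(f,g)=\lim_{\alpha=\beta\to0^+}\frac{\log(1/\alpha)}{D(T)}$, the limit taken along the family of tests for which $\alpha=\beta\to0$. Flip attack $g^*$: let $\mathcal{O}_1=\{1,\dots,c\}$, $\mathcal{O}_2=\{s-c+1,\dots,s\}$. If $\theta=0$, for each $k$ and $i\in\mathcal{O}_1$ the attacker draws an independent $\tilde x_i(k)$ with law $\mu$ and sets $x^a_i(k)=\tilde x_i(k)-x_i(k)$; if $\theta=1$, for each $k$ and $i\in\mathcal{O}_2$ it draws an independent $\tilde x_i(k)$ with law $\nu$ and sets $x^a_i(k)=\tilde x_i(k)-x_i(k)$; all other entries of $x^a(k)$ are $0$. *)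

theory Defs
  imports "HOL-Probability.Probability"
begin

text \<open>Decisions of a detection strategy at a given time.  Decide False = state 0,
  Decide True = state 1.  The binary state theta is encoded as bool (True = 1).\<close>
datatype decision = Continue | Decide bool

text \<open>Underlying probability space under state theta.  A sample point is
  w :: nat * nat * bool => real; w (k,i,False) is the true observation x_i(k),
  w (k,i,True) is the attacker's auxiliary draw x~_i(k) used by the flip attack.
  All coordinates are independent; x_i(k) has law mu if theta = 1 and nu if theta = 0;
  x~_i(k) has law mu if theta = 0 and nu if theta = 1.\<close>
definition sample_space ::
  "real measure \<Rightarrow> real measure \<Rightarrow> bool \<Rightarrow> (nat \<times> nat \<times> bool \<Rightarrow> real) measure" where
  "sample_space \<mu> \<nu> \<theta> =
     PiM UNIV (\<lambda>(k, i, b). if b then (if \<theta> then \<nu> else \<mu>) else (if \<theta> then \<mu> else \<nu>))"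

definition true_obs :: "(nat \<times> nat \<times> bool \<Rightarrow> real) \<Rightarrow> nat \<Rightarrow> nat \<Rightarrow> real" where
  "true_obs w k i = w (k, i, False)"

definition flip_attack ::
  "nat \<Rightarrow> nat \<Rightarrow> bool \<Rightarrow> (nat \<times> nat \<times> bool \<Rightarrow> real) \<Rightarrow> nat \<Rightarrow> nat \<Rightarrow> real" where
  "flip_attack s c \<theta> w k i =
     (if \<not> \<theta> \<and> i \<in> {1..c} then w (k, i, True) - true_obs w k i
      else if \<theta> \<and> i \<in> {s - c + 1..s} then w (k, i, True) - true_obs w k i
      else 0)"

definition manipulated ::
  "nat \<Rightarrow> nat \<Rightarrow> bool \<Rightarrow> (nat \<times> nat \<times> bool \<Rightarrow> real) \<Rightarrow> nat \<Rightarrow> nat \<Rightarrow> real" where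
  "manipulated s c \<theta> w k i = true_obs w k i + flip_attack s c \<theta> w k i"

definition obs_upto :: "nat \<Rightarrow> nat \<Rightarrow> (nat \<Rightarrow> nat \<Rightarrow> real) \<Rightarrow> (nat \<times> nat \<Rightarrow> real)" where
  "obs_upto s k y = restrict (\<lambda>(j, i). y j i) ({1..k} \<times> {1..s})"

definition detection_strategy :: "nat \<Rightarrow> (nat \<Rightarrow> (nat \<times> nat \<Rightarrow> real) \<Rightarrow> decision) \<Rightarrow> bool" where
  "detection_strategy s f \<longleftrightarrow>
     (\<forall>k. f k \<in> measurable (PiM ({1..k} \<times> {1..s}) (\<lambda>_. borel)) (count_space UNIV))"

definition stop_time :: "nat \<Rightarrow> (nat \<Rightarrow> (nat \<times> nat \<Rightarrow> real) \<Rightarrow> decision) \<Rightarrow> (nat \<Rightarrow> nat \<Rightarrow> real) \<Rightarrow> ennreal" where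
  "stop_time s f y =
     (if \<exists>k\<ge>1. f k (obs_upto s k y) \<noteq> Continue
      then of_nat (LEAST k. k \<ge> 1 \<and> f k (obs_upto s k y) \<noteq> Continue) else \<infinity>)"

definition decides :: "nat \<Rightarrow> (nat \<Rightarrow> (nat \<times> nat \<Rightarrow> real) \<Rightarrow> decision) \<Rightarrow> (nat \<Rightarrow> nat \<Rightarrow> real) \<Rightarrow> bool \<Rightarrow> bool" where
  "decides s f y d \<longleftrightarrow>
     (\<exists>k\<ge>1. f k (obs_upto s k y) = Decide d \<and> (\<forall>j. 1 \<le> j \<and> j < k \<longrightarrow> f j (obs_upto s j y) = Continue))"

definition flip_decision_prob ::
  "real measure \<Rightarrow> real measure \<Rightarrow> nat \<Rightarrow> nat \<Rightarrow> (nat \<Rightarrow> (nat \<times> nat \<Rightarrow> real) \<Rightarrow> decision) \<Rightarrow> bool \<Rightarrow> bool \<Rightarrow> real" where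
  "flip_decision_prob \<mu> \<nu> s c f \<theta> d =
     measure (sample_space \<mu> \<nu> \<theta>) {w \<in> space (sample_space \<mu> \<nu> \<theta>). decides s f (manipulated s c \<theta> w) d}"

definition flip_alpha where "flip_alpha \<mu> \<nu> s c f = flip_decision_prob \<mu> \<nu> s c f False True"
definition flip_beta where "flip_beta \<mu> \<nu> s c f = flip_decision_prob \<mu> \<nu> s c f True False"

definition flip_delay ::
  "real measure \<Rightarrow> real measure \<Rightarrow> nat \<Rightarrow> nat \<Rightarrow> (nat \<Rightarrow> (nat \<times> nat \<Rightarrow> real) \<Rightarrow> decision) \<Rightarrow> ennreal" where
  "flip_delay \<mu> \<nu> s c f =
     max (\<integral>\<^sup>+ w. stop_time s f (manipulated s c False w) \<partial>sample_space \<mu> \<nu> False)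
         (\<integral>\<^sup>+ w. stop_time s f (manipulated s c True w) \<partial>sample_space \<mu> \<nu> True)"

definition info1 :: "real measure \<Rightarrow> real measure \<Rightarrow> real" where
  "info1 \<mu> \<nu> = (\<integral>x. ln (enn2real (RN_deriv \<nu> \<mu> x)) \<partial>\<mu>)"
definition info0 :: "real measure \<Rightarrow> real measure \<Rightarrow> real" where
  "info0 \<mu> \<nu> = - (\<integral>x. ln (enn2real (RN_deriv \<nu> \<mu> x)) \<partial>\<nu>)"

end

theory Submission
  imports Defs
begin

text \<open>Under the flip attack the first \<open>c\<close> sensors always show law \<open>\<mu>\<close> and the last \<open>c\<close> always show
  \<open>\<nu>\<close>, so only \<open>s - 2c\<close> sensors carry information about the state. By Wald's identity the expected
  log-likelihood ratio at the stopping time \<open>T\<close> (truncated at \<open>n\<close>) is at most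
  \<open>(s - 2c) I\<^sub>\<theta> E\<^sub>\<theta>[T]\<close>. On the other hand the tangent bound \<open>exp (a - L) \<ge> 1 + a - L\<close>, integrated over
  the events of each decision with \<open>a = log (1/\<alpha>)\<close>, bounds it from below by
  \<open>(1 - \<beta>) log (1/\<alpha>) - 2\<close>. Dividing by \<open>log (1/\<alpha>)\<close> and letting \<open>\<alpha> = \<beta> \<rightarrow> 0\<close> gives the claim for both
  values of \<open>\<theta>\<close>.\<close>

section \<open>Product measures: densities and independence of coordinates\<close>

text \<open>A finite product measure is determined by its values on boxes. There the indicator
  factorises like the density, so the integral splits into one factor per coordinate.\<close>

lemma PiM_density:
  fixes g :: "'i \<Rightarrow> 'a \<Rightarrow> ennreal"
  assumes "finite I"
    and "\<And>i. prob_space (M i)" and "\<And>i. prob_space (density (M i) (g i))"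
    and [measurable]: "\<And>i. g i \<in> borel_measurable (M i)"
  shows "PiM I (\<lambda>i. density (M i) (g i)) = density (PiM I M) (\<lambda>x. \<Prod>i\<in>I. g i (x i))"
proof -
  interpret M: product_sigma_finite M
    by (simp add: assms(2) product_sigma_finite_def prob_space_imp_sigma_finite)
  interpret D: product_sigma_finite "\<lambda>i. density (M i) (g i)"
    by (simp add: assms(3) product_sigma_finite_def prob_space_imp_sigma_finite)
  show ?thesis
  proof (rule D.PiM_eqI[symmetric, OF \<open>finite I\<close>])
    show "sets (density (PiM I M) (\<lambda>x. \<Prod>i\<in>I. g i (x i))) = sets (PiM I (\<lambda>i. density (M i) (g i)))"
      by (simp cong: sets_PiM_cong)
  next
    fix A assume "\<And>i. i \<in> I \<Longrightarrow> A i \<in> sets (density (M i) (g i))"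
    then have A[measurable]: "\<And>i. i \<in> I \<Longrightarrow> A i \<in> sets (M i)" by simp
    have box: "Pi\<^sub>E I A \<in> sets (PiM I M)"
      using A \<open>finite I\<close> by (intro sets_PiM_I_finite)
    have "emeasure (density (PiM I M) (\<lambda>x. \<Prod>i\<in>I. g i (x i))) (Pi\<^sub>E I A)
        = (\<integral>\<^sup>+x. (\<Prod>i\<in>I. g i (x i)) * indicator (Pi\<^sub>E I A) x \<partial>PiM I M)"
      using box by (subst emeasure_density) auto
    also have "\<dots> = (\<integral>\<^sup>+x. (\<Prod>i\<in>I. g i (x i) * indicator (A i) (x i)) \<partial>PiM I M)"
    proof (rule nn_integral_cong)
      fix x assume "x \<in> space (PiM I M)"
      then have "x \<in> extensional I" by (simp add: space_PiM PiE_iff)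
      \<comment> \<open>Membership in \<open>Pi\<^sub>E I A\<close> also demands extensionality,
        hence the restriction to points of the space.\<close>
      then have "indicator (Pi\<^sub>E I A) x = (\<Prod>i\<in>I. indicator (A i) (x i) :: ennreal)"
        using \<open>finite I\<close> by (auto simp: indicator_def PiE_iff prod_zero_iff)
      then show "(\<Prod>i\<in>I. g i (x i)) * indicator (Pi\<^sub>E I A) x
          = (\<Prod>i\<in>I. g i (x i) * indicator (A i) (x i))"
        by (simp add: prod.distrib)
    qed
    also have "\<dots> = (\<Prod>i\<in>I. \<integral>\<^sup>+x. g i x * indicator (A i) x \<partial>M i)"
      using \<open>finite I\<close> by (intro M.product_nn_integral_prod) auto
    also have "\<dots> = (\<Prod>i\<in>I. emeasure (density (M i) (g i)) (A i))"
      by (intro prod.cong refl) (simp add: emeasure_density)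
    finally show "emeasure (density (PiM I M) (\<lambda>x. \<Prod>i\<in>I. g i (x i))) (Pi\<^sub>E I A)
        = (\<Prod>i\<in>I. emeasure (density (M i) (g i)) (A i))" .
  qed
qed

lemma integrable_PiM_coordinate:
  fixes h :: "'a \<Rightarrow> real"
  assumes "\<And>i. prob_space (M i)" "j \<in> I" "integrable (M j) h"
  shows "integrable (PiM I M) (\<lambda>x. h (x j))"
  using assms distr_PiM_component[of I M j]
  by (subst integrable_distr_eq[symmetric, where N = "M j"]) auto

text \<open>Independence of a fresh coordinate from an event about the coordinates in
  \<open>J\<close>: pass to the finite product over \<open>insert j J\<close> and integrate out
  coordinate \<open>j\<close> first. This drives Wald's identity below.\<close>

lemma integral_PiM_coordinate_times_indicator:
  fixes h :: "'a \<Rightarrow> real"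
  assumes "finite J" "j \<notin> J" and M: "\<And>i. prob_space (M i)"
    and h: "integrable (M j) h" and A: "A \<in> sets (PiM J M)"
  shows "(\<integral>x. h (x j) * indicator A (restrict x J) \<partial>PiM UNIV M)
    = (\<integral>x. h x \<partial>M j) * measure (PiM UNIV M) {x \<in> space (PiM UNIV M). restrict x J \<in> A}"
proof -
  interpret M: product_prob_space M UNIV
    by (simp add: M prob_space_imp_sigma_finite product_prob_space.intro
        product_sigma_finite_def product_prob_space_axioms_def)
  interpret P: prob_space "PiM UNIV M" by (rule prob_space_PiM) (rule M)
  interpret J: prob_space "PiM J M" by (rule prob_space_PiM) (rule M)
  have [measurable]: "h \<in> borel_measurable (M j)" using h by auto
  note A[measurable]
  let ?K = "insert j J"
  have "(\<integral>x. h (x j) * indicator A (restrict x J) \<partial>PiM UNIV M)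
      = (\<integral>x. h (x j) * indicator A (restrict x J)
          \<partial>distr (PiM UNIV M) (PiM ?K M) (\<lambda>x. restrict x ?K))"
    by (subst integral_distr) (auto intro!: Bochner_Integration.integral_cong
        simp: Int_absorb2 Int_commute subset_insertI)
  also have "\<dots> = (\<integral>x. h (x j) * indicator A (restrict x J) \<partial>PiM ?K M)"
    using assms by (subst M.distr_PiM_restrict_finite) auto
  also have "\<dots> = (\<integral>x. (\<integral>y. h ((x(j := y)) j) * indicator A (restrict (x(j := y)) J) \<partial>M j) \<partial>PiM J M)"
  proof (rule M.product_integral_insert[OF assms(1,2)])
    have m: "(\<lambda>x. indicator A (restrict x J) :: real) \<in> borel_measurable (PiM ?K M)" by measurable
    show "integrable (PiM ?K M) (\<lambda>x. h (x j) * indicator A (restrict x J))"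
      by (rule Bochner_Integration.integrable_bound[OF integrable_PiM_coordinate[where M = M and j = j and h = h]])
        (use m M h in \<open>auto simp: indicator_def\<close>)
  qed
  also have "\<dots> = (\<integral>x. (\<integral>y. h y \<partial>M j) * indicator A x \<partial>PiM J M)"
  proof (rule Bochner_Integration.integral_cong[OF refl])
    fix x assume "x \<in> space (PiM J M)"
    then have "restrict (x(j := y)) J = x" for y
      using \<open>j \<notin> J\<close> by (auto simp: space_PiM PiE_iff extensional_def restrict_def fun_eq_iff)
    then show "(\<integral>y. h ((x(j := y)) j) * indicator A (restrict (x(j := y)) J) \<partial>M j)
        = (\<integral>y. h y \<partial>M j) * indicator A x"
      by simp
  qed
  also have "\<dots> = (\<integral>y. h y \<partial>M j) * measure (PiM J M) A"
    using sets.sets_into_space[OF A] by (simp add: Int_absorb2)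
  also have "measure (PiM J M) A = measure (distr (PiM UNIV M) (PiM J M) (\<lambda>x. restrict x J)) A"
    using assms by (subst M.distr_PiM_restrict_finite) auto
  also have "\<dots> = measure (PiM UNIV M) {x \<in> space (PiM UNIV M). restrict x J \<in> A}"
    by (subst measure_distr) (auto intro!: arg_cong[where f = "measure _"])
  finally show "(\<integral>x. h (x j) * indicator A (restrict x J) \<partial>PiM UNIV M)
    = (\<integral>x. h x \<partial>M j) * measure (PiM UNIV M) {x \<in> space (PiM UNIV M). restrict x J \<in> A}" .
qed

section \<open>Sequential tests between two laws with independent observations\<close>

text \<open>An index is a pair of time and sensor. Leaving the time out of the marginal makes each
  sensor's observations identically distributed over time.\<close>

definition obs_law :: "(nat \<Rightarrow> real measure) \<Rightarrow> (nat \<times> nat \<Rightarrow> real) measure" where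
  "obs_law q = PiM UNIV (\<lambda>j. q (snd j))"

definition grid :: "nat \<Rightarrow> nat \<Rightarrow> (nat \<times> nat) set" where
  "grid s k = {1..k} \<times> {1..s}"

lemma finite_grid [simp]: "finite (grid s k)"
  by (simp add: grid_def)

lemma grid_mono: "j \<le> k \<Longrightarrow> grid s j \<subseteq> grid s k"
  by (auto simp: grid_def)

lemma grid_Suc: "grid s (Suc k) = grid s k \<union> {Suc k} \<times> {1..s}"
  by (auto simp: grid_def)

text \<open>\<open>q\<close> generates the data, \<open>p\<close> is the rival hypothesis, and
  \<open>l i\<close> is the log-likelihood ratio of \<open>q i\<close> against \<open>p i\<close>.
  Keeping the two roles abstract lets either state be the true one.\<close>

locale sequential_test =
  fixes q p :: "nat \<Rightarrow> real measure" and l :: "nat \<Rightarrow> real \<Rightarrow> real" and s :: nat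
    and f :: "nat \<Rightarrow> (nat \<times> nat \<Rightarrow> real) \<Rightarrow> decision"
  assumes prob_q: "\<And>i. prob_space (q i)" and prob_p: "\<And>i. prob_space (p i)"
    and sets_q: "\<And>i. sets (q i) = sets borel"
    and p_eq: "\<And>i. p i = density (q i) (\<lambda>x. ennreal (exp (- l i x)))"
    and l_meas: "\<And>i. l i \<in> borel_measurable borel"
    and l_int: "\<And>i. integrable (q i) (l i)"
    and strategy: "detection_strategy s f"
begin

abbreviation "Q \<equiv> obs_law q"
abbreviation "P \<equiv> obs_law p"

sublocale Q: prob_space Q
  unfolding obs_law_def by (intro prob_space_PiM prob_q)
sublocale P: prob_space P
  unfolding obs_law_def by (intro prob_space_PiM prob_p)

lemma sets_p: "sets (p i) = sets borel"
  by (simp add: p_eq sets_q)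

lemma sets_obs_law [measurable_cong]:
  "sets Q = sets (PiM UNIV (\<lambda>_. borel))" "sets P = sets (PiM UNIV (\<lambda>_. borel))"
  unfolding obs_law_def by (intro sets_PiM_cong; simp add: sets_q sets_p)+

lemma space_obs_law [simp]: "space Q = UNIV" "space P = UNIV"
  using sets_obs_law[THEN sets_eq_imp_space_eq] by (simp_all add: space_PiM)

definition stage :: "nat \<Rightarrow> (nat \<times> nat \<Rightarrow> real) \<Rightarrow> decision" where
  "stage k y = f k (restrict y (grid s k))"

text \<open>For the stopping time T this is the event T > k, which always holds at k = 0. Summing
  its probabilities over all k gives the expectation of T.\<close>

definition running :: "nat \<Rightarrow> (nat \<times> nat \<Rightarrow> real) \<Rightarrow> bool" where
  "running k y \<longleftrightarrow> (\<forall>j\<in>{1..k}. stage j y = Continue)"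

text \<open>Off by one: this is the event that the test stops at time \<^term>\<open>Suc k\<close>.\<close>
definition stops :: "bool \<Rightarrow> nat \<Rightarrow> (nat \<times> nat \<Rightarrow> real) \<Rightarrow> bool" where
  "stops d k y \<longleftrightarrow> running k y \<and> stage (Suc k) y = Decide d"

definition llr :: "nat \<Rightarrow> (nat \<times> nat \<Rightarrow> real) \<Rightarrow> real" where
  "llr k y = (\<Sum>j\<in>grid s k. l (snd j) (y j))"

text \<open>The Kullback-Leibler divergence of \<open>q\<close> from \<open>p\<close> gained in one
  time step, added up over the sensors.\<close>

definition info :: real where
  "info = (\<Sum>i=1..s. \<integral>x. l i x \<partial>q i)"

text \<open>Membership in the sigma-algebra of the first \<open>k\<close> times. The invariance
  under restriction allows the same predicate to be used on the finite grid and on the infinite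
  product.\<close>

definition adapted :: "nat \<Rightarrow> ((nat \<times> nat \<Rightarrow> real) \<Rightarrow> bool) \<Rightarrow> bool" where
  "adapted k R \<longleftrightarrow> Measurable.pred (PiM (grid s k) (\<lambda>_. borel)) R
     \<and> (\<forall>y. R (restrict y (grid s k)) = R y)"

lemma stage_measurable:
  assumes "j \<le> k"
  shows "stage j \<in> measurable (PiM (grid s k) (\<lambda>_. borel)) (count_space UNIV)"
proof -
  have f: "f j \<in> measurable (PiM (grid s j) (\<lambda>_. borel)) (count_space UNIV)"
    using strategy by (simp add: detection_strategy_def grid_def)
  have "(\<lambda>y. restrict y (grid s j)) \<in> measurable (PiM (grid s k) (\<lambda>_. borel :: real measure))
      (PiM (grid s j) (\<lambda>_. borel))"
    using grid_mono[OF assms] by (rule measurable_restrict_subset)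
  from measurable_compose[OF this f] show ?thesis
    by (simp add: stage_def[abs_def])
qed

lemma stage_restrict: "j \<le> k \<Longrightarrow> stage j (restrict y (grid s k)) = stage j y"
  using grid_mono[of j k s] by (simp add: stage_def Int_absorb1)

lemma adapted_running: "adapted k (running k)"
proof -
  have "Measurable.pred (PiM (grid s k) (\<lambda>_. borel)) (running k)"
    unfolding running_def[abs_def]
    using stage_measurable[of _ k] by (intro pred_intros_finite) (auto intro!: pred_eq_const1)
  then show ?thesis
    by (auto simp: adapted_def running_def stage_restrict)
qed

lemma adapted_stops: "adapted (Suc k) (stops d k)"
proof -
  have "Measurable.pred (PiM (grid s (Suc k)) (\<lambda>_. borel)) (stops d k)"
    unfolding running_def[abs_def] stops_def[abs_def]
    using stage_measurable[of _ "Suc k"]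
    by (intro pred_intros_logic pred_intros_finite) (auto intro!: pred_eq_const1)
  then show ?thesis
    by (auto simp: adapted_def stops_def running_def stage_restrict)
qed

lemma restrict_grid_measurable:
  "(\<lambda>y. restrict y (grid s k)) \<in> measurable (PiM UNIV (\<lambda>_. borel)) (PiM (grid s k) (\<lambda>_. borel :: real measure))"
  by (rule measurable_restrict_subset) simp

lemma adapted_pred:
  assumes "adapted k R"
  shows "Measurable.pred (PiM UNIV (\<lambda>_. borel)) R"
proof -
  have "Measurable.pred (PiM UNIV (\<lambda>_. borel)) (\<lambda>y. R (restrict y (grid s k)))"
    using measurable_compose[OF restrict_grid_measurable] assms unfolding adapted_def by blast
  then show ?thesis using assms by (simp add: adapted_def)
qed

lemma adapted_sets:
  assumes "adapted k R"
  shows "{y. R y} \<in> sets Q" "{y. R y} \<in> sets P"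
  using adapted_pred[OF assms] by (auto simp: sets_obs_law pred_def space_PiM)

lemma llr_measurable [measurable]: "llr k \<in> borel_measurable Q"
proof -
  note l_meas[measurable]
  show ?thesis unfolding llr_def[abs_def] measurable_cong_sets[OF sets_obs_law(1) refl]
    by measurable
qed

lemma integrable_coordinate: "integrable Q (\<lambda>y. l (snd j) (y j))"
  unfolding obs_law_def by (rule integrable_PiM_coordinate) (auto simp: prob_q l_int)

lemma integrable_llr: "integrable Q (llr k)"
  unfolding llr_def[abs_def] by (intro Bochner_Integration.integrable_sum integrable_coordinate)

lemma integrable_times_event:
  fixes h :: "(nat \<times> nat \<Rightarrow> real) \<Rightarrow> real"
  assumes "adapted k R" "integrable Q h"
  shows "integrable Q (\<lambda>y. h y * indicator {y. R y} y)"
  using adapted_sets(1)[OF assms(1)] assms(2) by (rule integrable_real_mult_indicator)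

section \<open>Change of measure and Wald's identity\<close>

text \<open>The infinite products need not have a density against each other, but their projections
  to the grid do, namely \<open>exp (- llr k)\<close>. An adapted event is decided on the grid, so
  \<open>P\<close> is projected, rewritten there, and lifted back to \<open>Q\<close>.\<close>

lemma change_of_measure:
  assumes "adapted k R"
  shows "emeasure P {y. R y} = (\<integral>\<^sup>+y. ennreal (exp (- llr k y)) * indicator {y. R y} y \<partial>Q)"
proof -
  let ?B = "grid s k"
  let ?q = "PiM ?B (\<lambda>j. q (snd j))" and ?p = "PiM ?B (\<lambda>j. p (snd j))"
  let ?A = "{x \<in> space (PiM ?B (\<lambda>_. borel)). R x}"
  note l_meas[measurable]
  interpret q: product_prob_space "\<lambda>j. q (snd j)" UNIV
    by (simp add: prob_q prob_space_imp_sigma_finite product_prob_space.intro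
        product_sigma_finite_def product_prob_space_axioms_def)
  interpret p: product_prob_space "\<lambda>j. p (snd j)" UNIV
    by (simp add: prob_p prob_space_imp_sigma_finite product_prob_space.intro
        product_sigma_finite_def product_prob_space_axioms_def)
  have sets_B [measurable_cong]: "sets ?q = sets (PiM ?B (\<lambda>_. borel))" "sets ?p = sets (PiM ?B (\<lambda>_. borel))"
    by (intro sets_PiM_cong; simp add: sets_q sets_p)+
  have A: "?A \<in> sets (PiM ?B (\<lambda>_. borel))"
    using assms by (auto simp: adapted_def pred_def)
  have restr: "(\<lambda>y. restrict y ?B) \<in> measurable P ?p" "(\<lambda>y. restrict y ?B) \<in> measurable Q ?q"
    using restrict_grid_measurable[of k]
    by (simp_all cong: measurable_cong_sets add: sets_obs_law sets_B)
  have mem: "restrict y ?B \<in> ?A \<longleftrightarrow> R y" for y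
    using assms by (auto simp: adapted_def space_PiM)
  have ind: "indicator ?A (restrict y ?B) = (indicator {y. R y} y :: ennreal)" for y
    unfolding indicator_def mem by simp
  have llr_meas: "llr k \<in> borel_measurable ?q"
    unfolding llr_def[abs_def] measurable_cong_sets[OF sets_B(1) refl] by measurable
  have llr_restr: "llr k (restrict y ?B) = llr k y" for y
    by (simp add: llr_def)
  have "emeasure P {y. R y} = emeasure (distr P ?p (\<lambda>y. restrict y ?B)) ?A"
    using A restr mem by (subst emeasure_distr) (auto simp: sets_B vimage_def simp del: restrict_apply)
  also have "distr P ?p (\<lambda>y. restrict y ?B) = ?p"
    unfolding obs_law_def by (rule p.distr_PiM_restrict_finite) auto
  also have "?p = PiM ?B (\<lambda>j. density (q (snd j)) (\<lambda>x. ennreal (exp (- l (snd j) x))))"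
    by (simp add: p_eq)
  also have "\<dots> = density ?q (\<lambda>x. \<Prod>j\<in>?B. ennreal (exp (- l (snd j) (x j))))"
    using prob_p by (intro PiM_density) (auto simp: prob_q p_eq cong: measurable_cong_sets[OF sets_q refl])
  also have "\<dots> = density ?q (\<lambda>x. ennreal (exp (- llr k x)))"
    by (simp add: prod_ennreal llr_def sum_negf[symmetric] exp_sum)
  also have "emeasure \<dots> ?A = (\<integral>\<^sup>+x. ennreal (exp (- llr k x)) * indicator ?A x \<partial>?q)"
    using A llr_meas by (intro emeasure_density) (auto simp: sets_B)
  also have "?q = distr Q ?q (\<lambda>y. restrict y ?B)"
    unfolding obs_law_def by (rule q.distr_PiM_restrict_finite[symmetric]) auto
  also have "(\<integral>\<^sup>+x. ennreal (exp (- llr k x)) * indicator ?A x \<partial>distr Q ?q (\<lambda>y. restrict y ?B))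
      = (\<integral>\<^sup>+y. ennreal (exp (- llr k y)) * indicator {y. R y} y \<partial>Q)"
    using A restr llr_meas
    by (subst nn_integral_distr) (simp_all add: sets_B llr_restr ind)
  finally show ?thesis .
qed

text \<open>Integrate the tangent bound \<open>exp (a - L) \<ge> 1 + a - L\<close> for the log-likelihood ratio \<open>L\<close>
  over the event.\<close>
lemma integral_llr_ge:
  assumes "adapted k R"
  shows "(1 + a) * measure Q {y. R y} - exp a * measure P {y. R y}
    \<le> (\<integral>y. llr k y * indicator {y. R y} y \<partial>Q)"
proof -
  let ?R = "{y. R y}"
  note R = adapted_sets[OF assms]
  \<comment> \<open>Integrability comes from the change of measure, which identifies the integral
    with a probability under \<open>P\<close>.\<close>
  have int: "integrable Q (\<lambda>y. exp (- llr k y) * indicator ?R y)"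
    and eq: "(\<integral>y. exp (- llr k y) * indicator ?R y \<partial>Q) = measure P ?R"
  proof -
    have nn: "(\<integral>\<^sup>+y. ennreal (exp (- llr k y) * indicator ?R y) \<partial>Q) = ennreal (measure P ?R)"
      using change_of_measure[OF assms]
      by (simp add: P.emeasure_eq_measure ennreal_mult ennreal_indicator)
    then show int: "integrable Q (\<lambda>y. exp (- llr k y) * indicator ?R y)"
      using R by (intro integrableI_nonneg) auto
    show "(\<integral>y. exp (- llr k y) * indicator ?R y \<partial>Q) = measure P ?R"
      using R by (subst integral_eq_nn_integral) (auto simp: nn)
  qed
  have iL: "integrable Q (\<lambda>y. llr k y * indicator ?R y)"
    by (rule integrable_times_event[OF assms integrable_llr])
  have i0: "integrable Q (indicator ?R :: _ \<Rightarrow> real)"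
    using R by (intro integrable_real_indicator) (auto simp: less_top[symmetric])
  then have i1: "integrable Q (\<lambda>y. (1 + a) * indicator ?R y)"
    by (rule integrable_mult_right)
  have "(1 + a) * measure Q ?R - exp a * measure P ?R
      = (\<integral>y. (1 + a) * indicator ?R y - exp a * (exp (- llr k y) * indicator ?R y) \<partial>Q)"
    using R int i0 by (subst Bochner_Integration.integral_diff) (simp_all add: eq integrable_mult_right)
  also have "\<dots> \<le> (\<integral>y. llr k y * indicator ?R y \<partial>Q)"
  proof (rule integral_mono)
    show "integrable Q (\<lambda>y. (1 + a) * indicator ?R y - exp a * (exp (- llr k y) * indicator ?R y))"
      by (intro Bochner_Integration.integrable_diff i1 integrable_mult_right int)
    fix y
    have "1 + (a - llr k y) \<le> exp (a - llr k y)" by (rule exp_ge_add_one_self)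
    then show "(1 + a) * indicator ?R y - exp a * (exp (- llr k y) * indicator ?R y)
        \<le> llr k y * indicator ?R y"
      by (auto simp: indicator_def exp_diff exp_minus field_simps)
  qed (rule iL)
  finally show ?thesis .
qed

text \<open>The increment of the log-likelihood ratio at time \<open>Suc k\<close> has mean
  \<open>info\<close> and is independent of anything decided by time \<open>k\<close>.\<close>

lemma integral_llr_Suc:
  assumes "adapted k R"
  shows "(\<integral>y. llr (Suc k) y * indicator {y. R y} y \<partial>Q)
    = (\<integral>y. llr k y * indicator {y. R y} y \<partial>Q) + info * measure Q {y. R y}"
proof -
  let ?R = "{y. R y}" and ?B = "grid s k"
  let ?A = "{x \<in> space (PiM ?B (\<lambda>_. borel)). R x}"
  have A: "?A \<in> sets (PiM ?B (\<lambda>j. q (snd j)))"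
    using assms by (auto simp: adapted_def pred_def sets_q cong: sets_PiM_cong)
  have mem: "restrict y ?B \<in> ?A \<longleftrightarrow> R y" for y
    using assms by (auto simp: adapted_def space_PiM)
  have llr_Suc: "llr (Suc k) y = llr k y + (\<Sum>i=1..s. l i (y (Suc k, i)))" for y
  proof -
    have "llr (Suc k) y = llr k y + (\<Sum>j\<in>{Suc k} \<times> {1..s}. l (snd j) (y j))"
      unfolding llr_def grid_Suc by (subst sum.union_disjoint) (auto simp: grid_def)
    also have "(\<Sum>j\<in>{Suc k} \<times> {1..s}. l (snd j) (y j)) = (\<Sum>i=1..s. l i (y (Suc k, i)))"
      by (rule sum.reindex_bij_witness[of _ "\<lambda>i. (Suc k, i)" snd]) auto
    finally show ?thesis .
  qed
  have term_eq: "(\<integral>y. l i (y (Suc k, i)) * indicator ?R y \<partial>Q) = (\<integral>x. l i x \<partial>q i) * measure Q ?R" for i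
  proof -
    \<comment> \<open>Independence applies because \<open>(Suc k, i)\<close> lies outside
      \<open>grid s k\<close>.\<close>
    have "(\<integral>y. l i (y (Suc k, i)) * indicator ?A (restrict y ?B) \<partial>PiM UNIV (\<lambda>j. q (snd j)))
        = (\<integral>x. l i x \<partial>q (snd (Suc k, i)))
          * measure (PiM UNIV (\<lambda>j. q (snd j))) {y \<in> space (PiM UNIV (\<lambda>j. q (snd j))). restrict y ?B \<in> ?A}"
      by (rule integral_PiM_coordinate_times_indicator) (auto simp: prob_q l_int A, auto simp: grid_def)
    then show ?thesis
      unfolding obs_law_def[symmetric] mem indicator_def by simp
  qed
  have int: "integrable Q (\<lambda>y. l i (y (Suc k, i)) * indicator ?R y)" for i
    using integrable_times_event[OF assms integrable_coordinate[of "(Suc k, i)"]] by simp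
  have "(\<integral>y. llr (Suc k) y * indicator ?R y \<partial>Q)
      = (\<integral>y. llr k y * indicator ?R y + (\<Sum>i=1..s. l i (y (Suc k, i)) * indicator ?R y) \<partial>Q)"
    by (simp add: llr_Suc distrib_right sum_distrib_right)
  also have "\<dots> = (\<integral>y. llr k y * indicator ?R y \<partial>Q)
      + (\<Sum>i=1..s. \<integral>y. l i (y (Suc k, i)) * indicator ?R y \<partial>Q)"
    using int integrable_times_event[OF assms integrable_llr]
    by (simp only: Bochner_Integration.integral_add Bochner_Integration.integral_sum
        Bochner_Integration.integrable_sum)
  finally show ?thesis
    by (simp add: term_eq info_def sum_distrib_right)
qed

text \<open>A test that has not stopped by time n either continues at time n + 1 or takes exactly
  one of the two decisions.\<close>

lemma indicator_running:
  "(indicator {y. running n y} y :: real) = indicator {y. running (Suc n) y} y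
    + (indicator {y. stops d n y} y + indicator {y. stops (\<not> d) n y} y)"
proof (cases "running n y")
  case True
  then have "running (Suc n) y \<longleftrightarrow> stage (Suc n) y = Continue"
    by (auto simp: running_def atLeastAtMostSuc_conv)
  with True show ?thesis
    by (cases "stage (Suc n) y") (auto simp: indicator_def stops_def)
next
  case False
  then show ?thesis by (auto simp: indicator_def stops_def running_def)
qed

text \<open>Wald's identity for min(T, n): the left side is the expected log-likelihood ratio at
  that time, the sum on the right its expectation. In the induction step the increment adds
  \<open>info\<close> on \<open>running n\<close>, and that event is then split by the outcome at
  time n + 1.\<close>

lemma truncated_wald:
  "(\<integral>y. llr n y * indicator {y. running n y} y \<partial>Q)
     + (\<Sum>k<n. (\<integral>y. llr (Suc k) y * indicator {y. stops d k y} y \<partial>Q)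
         + (\<integral>y. llr (Suc k) y * indicator {y. stops (\<not> d) k y} y \<partial>Q))
   = info * (\<Sum>k<n. measure Q {y. running k y})"
proof (induction n)
  case 0
  show ?case by (simp add: llr_def grid_def)
next
  case (Suc n)
  have "(\<integral>y. llr (Suc n) y * indicator {y. running n y} y \<partial>Q)
     = (\<integral>y. llr (Suc n) y * indicator {y. running (Suc n) y} y
         + (llr (Suc n) y * indicator {y. stops d n y} y
         + llr (Suc n) y * indicator {y. stops (\<not> d) n y} y) \<partial>Q)"
    by (simp only: indicator_running[of n _ d] distrib_left)
  also have "\<dots> = (\<integral>y. llr (Suc n) y * indicator {y. running (Suc n) y} y \<partial>Q)
     + ((\<integral>y. llr (Suc n) y * indicator {y. stops d n y} y \<partial>Q)
     + (\<integral>y. llr (Suc n) y * indicator {y. stops (\<not> d) n y} y \<partial>Q))"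
    using integrable_times_event[OF adapted_running integrable_llr]
      integrable_times_event[OF adapted_stops integrable_llr]
    by (subst Bochner_Integration.integral_add, simp, simp)
      (subst Bochner_Integration.integral_add, auto)
  finally show ?case
    using Suc.IH integral_llr_Suc[OF adapted_running[of n]] by (simp add: algebra_simps)
qed

lemma prob_running_split:
  "measure P {y. running n y}
     + (\<Sum>k<n. measure P {y. stops d k y} + measure P {y. stops (\<not> d) k y}) = 1"
proof (induction n)
  case 0
  show ?case using P.prob_space by (simp add: running_def)
next
  case (Suc n)
  note sets = adapted_sets(2)[OF adapted_running] adapted_sets(2)[OF adapted_stops]
  have int: "integrable P (indicator {y. running k y} :: _ \<Rightarrow> real)"
    "integrable P (indicator {y. stops e k y} :: _ \<Rightarrow> real)" for k e
    using sets by (auto intro!: integrable_real_indicator simp: less_top[symmetric])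
  have "measure P {y. running n y} = (\<integral>y. indicator {y. running n y} y \<partial>P)"
    by simp
  also have "\<dots> = (\<integral>y. indicator {y. running (Suc n) y} y
    + (indicator {y. stops d n y} y + indicator {y. stops (\<not> d) n y} y) \<partial>P)"
    by (simp only: indicator_running[of n _ d])
  also have "\<dots> = measure P {y. running (Suc n) y}
    + (measure P {y. stops d n y} + measure P {y. stops (\<not> d) n y})"
    using int by simp
  finally show ?case using Suc.IH by simp
qed

text \<open>A test stops at most once, so the events are disjoint and countable additivity applies.
  \<open>M\<close> is generic in order to serve both \<open>Q\<close> and \<open>P\<close>.\<close>

lemma stops_sums:
  assumes "finite_measure M" "sets M = sets (PiM UNIV (\<lambda>_. borel))"
  shows "(\<lambda>k. measure M {y. stops d k y}) sums measure M {y. \<exists>k. stops d k y}"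
proof -
  interpret finite_measure M by fact
  have "disjoint_family (\<lambda>k. {y. stops d k y})"
  proof (unfold disjoint_family_on_def, intro ballI impI)
    fix m n :: nat assume "m \<noteq> n"
    have False if "stops d i y" "stops d j y" "i < j" for i j y
    proof -
      \<comment> \<open>Stopping at time \<open>Suc i\<close>, which is at most \<open>j\<close>,
        contradicts \<open>running j\<close>.\<close>
      have "Suc i \<in> {1..j}" using \<open>i < j\<close> by auto
      then show False using that by (auto simp: stops_def running_def)
    qed
    then show "{y. stops d m y} \<inter> {y. stops d n y} = {}"
      using \<open>m \<noteq> n\<close> by (auto simp: neq_iff)
  qed
  then have "(\<lambda>k. measure M {y. stops d k y}) sums measure M (\<Union>k. {y. stops d k y})"
    using adapted_sets(1)[OF adapted_stops, of d]
    by (intro finite_measure_UNION) (auto simp: assms(2) sets_obs_law)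
  also have "(\<Union>k. {y. stops d k y}) = {y. \<exists>k. stops d k y}" by auto
  finally show ?thesis .
qed

text \<open>Each term of the truncated Wald identity is bounded from below: with parameter
  \<open>a\<close> on decision \<open>d\<close>, and with parameter 0 on the other decision and on
  \<open>running n\<close>. The latter events have total \<open>P\<close>-mass at most 1, whence the
  \<open>- 1\<close>.\<close>

lemma finite_horizon_bound:
  assumes "0 \<le> a"
  shows "a * (\<Sum>k<n. measure Q {y. stops d k y}) - exp a * measure P {y. \<exists>k. stops d k y} - 1
    \<le> info * (\<Sum>k<n. measure Q {y. running k y})"
proof -
  let ?I = "\<lambda>e k. \<integral>y. llr (Suc k) y * indicator {y. stops e k y} y \<partial>Q"
  \<comment> \<open>At \<open>a = 0\<close> the bound reads Q(R) - P(R); the nonnegative Q(R) is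
    dropped.\<close>
  have *: "- measure P {y. running n y} \<le> (\<integral>y. llr n y * indicator {y. running n y} y \<partial>Q)"
    using integral_llr_ge[OF adapted_running, of 0 n] measure_nonneg[of Q "{y. running n y}"]
    unfolding add_0_right mult_1 exp_zero by linarith
  have d: "a * measure Q {y. stops d k y} - exp a * measure P {y. stops d k y} \<le> ?I d k" for k
    using integral_llr_ge[OF adapted_stops, of a d k] measure_nonneg[of Q "{y. stops d k y}"]
    unfolding distrib_right mult_1 by linarith
  have nd: "- measure P {y. stops (\<not> d) k y} \<le> ?I (\<not> d) k" for k
    using integral_llr_ge[OF adapted_stops, of 0 "\<not> d" k]
      measure_nonneg[of Q "{y. stops (\<not> d) k y}"]
    unfolding add_0_right mult_1 exp_zero by linarith
  have "(\<Sum>k<n. a * measure Q {y. stops d k y} - exp a * measure P {y. stops d k y}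
      - measure P {y. stops (\<not> d) k y}) \<le> (\<Sum>k<n. ?I d k + ?I (\<not> d) k)"
  proof (rule sum_mono)
    fix k
    show "a * measure Q {y. stops d k y} - exp a * measure P {y. stops d k y}
      - measure P {y. stops (\<not> d) k y} \<le> ?I d k + ?I (\<not> d) k"
      using d[of k] nd[of k] by linarith
  qed
  then have sum: "a * (\<Sum>k<n. measure Q {y. stops d k y}) - exp a * (\<Sum>k<n. measure P {y. stops d k y})
      - (\<Sum>k<n. measure P {y. stops (\<not> d) k y}) \<le> (\<Sum>k<n. ?I d k + ?I (\<not> d) k)"
    by (simp add: sum_subtractf sum_distrib_left)
  have P_d: "(\<Sum>k<n. measure P {y. stops d k y}) \<le> measure P {y. \<exists>k. stops d k y}"
    using stops_sums[OF P.finite_measure_axioms sets_obs_law(2), of d]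
    by (metis measure_nonneg sum_le_suminf sums_iff finite_lessThan)
  have P_nd: "measure P {y. running n y} + (\<Sum>k<n. measure P {y. stops (\<not> d) k y}) \<le> 1"
    using prob_running_split[of n d] sum_nonneg[of "{..<n}" "\<lambda>k. measure P {y. stops d k y}"]
    by (simp add: sum.distrib)
  have "exp a * (\<Sum>k<n. measure P {y. stops d k y}) \<le> exp a * measure P {y. \<exists>k. stops d k y}"
    using P_d by simp
  then show ?thesis
    using sum * P_nd truncated_wald[of n d] by linarith
qed

section \<open>Decisions, stopping time and the trade-off between error and delay\<close>

lemma obs_upto_curry: "f k (obs_upto s k (curry y)) = stage k y"
  by (simp add: obs_upto_def stage_def grid_def)

lemma decides_iff: "decides s f (curry y) d \<longleftrightarrow> (\<exists>k. stops d k y)"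
proof
  assume "decides s f (curry y) d"
  then obtain k where k: "1 \<le> k" "stage k y = Decide d"
      "\<And>j. 1 \<le> j \<Longrightarrow> j < k \<Longrightarrow> stage j y = Continue"
    unfolding decides_def obs_upto_curry by auto
  then have "stops d (k - 1) y" by (auto simp: stops_def running_def)
  then show "\<exists>k. stops d k y" ..
next
  assume "\<exists>k. stops d k y"
  then obtain k where "stops d k y" ..
  then show "decides s f (curry y) d"
    unfolding decides_def obs_upto_curry by (intro exI[of _ "Suc k"]) (auto simp: stops_def running_def)
qed

lemma decides_measurable [measurable]:
  "Measurable.pred (PiM UNIV (\<lambda>_. borel)) (\<lambda>y. decides s f (curry y) d)"
  using adapted_pred[OF adapted_stops] unfolding decides_iff by measurable

lemma stop_time_measurable [measurable]:
  "(\<lambda>y. stop_time s f (curry y)) \<in> borel_measurable (PiM UNIV (\<lambda>_. borel))"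
proof -
  have [measurable]: "stage k \<in> measurable (PiM UNIV (\<lambda>_. borel)) (count_space UNIV)" for k
    using measurable_compose[OF restrict_grid_measurable[of k] stage_measurable[of k k]]
    by (simp add: stage_restrict)
  show ?thesis unfolding stop_time_def obs_upto_curry by measurable
qed

text \<open>The sum counts the k < n with k < T, so it equals min(T, n). Integrated, it bounds the
  right side of Wald's identity by the expected delay.\<close>

lemma sum_running_le_stop_time:
  "(\<Sum>k<n. indicator {y. running k y} y) \<le> stop_time s f (curry y)"
proof (cases "\<exists>k\<ge>1. stage k y \<noteq> Continue")
  case True
  define T where "T = (LEAST k. 1 \<le> k \<and> stage k y \<noteq> Continue)"
  have "\<exists>k. 1 \<le> k \<and> stage k y \<noteq> Continue" using True by blast
  from LeastI_ex[OF this] have T: "1 \<le> T" "stage T y \<noteq> Continue"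
    unfolding T_def by auto
  have "k < T" if "running k y" for k
    using T that by (force simp: running_def not_less)
  then have "(\<Sum>k<n. indicator {y. running k y} y) \<le> (\<Sum>k<n. indicator {..<T} k :: ennreal)"
    by (intro sum_mono) (auto simp: indicator_def)
  also have "\<dots> = (\<Sum>k\<in>{..<n} \<inter> {..<T}. 1)"
    unfolding sum.inter_restrict[OF finite_lessThan]
    by (rule sum.cong) (auto split: split_indicator)
  also have "\<dots> = of_nat (card ({..<n} \<inter> {..<T}))"
    by simp
  also have "\<dots> \<le> of_nat T"
    using card_mono[of "{..<T}" "{..<n} \<inter> {..<T}"] by simp
  finally show ?thesis using True by (simp add: stop_time_def obs_upto_curry T_def)
next
  case False
  then show ?thesis by (auto simp: stop_time_def obs_upto_curry)
qed

text \<open>Finite expected delay makes the stopping time almost surely finite. By this lemma the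
  test then decides, so the correct decision has probability at least 1 - \<beta>.\<close>

lemma decides_of_finite_stop_time:
  assumes "stop_time s f (curry y) \<noteq> \<infinity>"
  shows "decides s f (curry y) d \<or> decides s f (curry y) (\<not> d)"
proof -
  define T where "T = (LEAST k. 1 \<le> k \<and> stage k y \<noteq> Continue)"
  have "\<exists>k. 1 \<le> k \<and> stage k y \<noteq> Continue"
    using assms by (auto simp: stop_time_def obs_upto_curry split: if_splits)
  from LeastI_ex[OF this] have T: "1 \<le> T" "stage T y \<noteq> Continue"
    unfolding T_def by auto
  then obtain e where "stage T y = Decide e" by (cases "stage T y") auto
  moreover have "stage j y = Continue" if "1 \<le> j" "j < T" for j
    using not_less_Least[of j "\<lambda>k. 1 \<le> k \<and> stage k y \<noteq> Continue"] that by (auto simp: T_def)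
  ultimately have "decides s f (curry y) e"
    unfolding decides_def obs_upto_curry using T by auto
  then show ?thesis by (cases "e = d") auto
qed

text \<open>\<open>d\<close> is the right decision under \<open>Q\<close> and the wrong one under
  \<open>P\<close>. The claim is the finite horizon bound with a suitable \<open>a\<close>, as the
  horizon tends to infinity.\<close>

lemma error_delay_tradeoff:
  fixes d :: bool
  defines "\<alpha> \<equiv> measure P {y. decides s f (curry y) d}"
    and "\<beta> \<equiv> measure Q {y. decides s f (curry y) (\<not> d)}"
    and "N \<equiv> (\<integral>\<^sup>+y. stop_time s f (curry y) \<partial>Q)"
  assumes "0 < \<alpha>" "0 \<le> info" "N \<noteq> \<infinity>"
  shows "(1 - \<beta>) * ln (1 / \<alpha>) - 2 \<le> info * enn2real N"
proof -
  \<comment> \<open>With this choice \<open>exp a * \<alpha>\<close> is 1, and together with the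
    \<open>- 1\<close> of the finite horizon bound the loss is 2.\<close>
  define a where "a = ln (1 / \<alpha>)"
  have "\<alpha> \<le> 1" unfolding \<alpha>_def by (rule P.prob_le_1)
  then have "0 \<le> a" using \<open>0 < \<alpha>\<close> by (simp add: a_def)
  have exp_a: "exp a * \<alpha> = 1" using \<open>0 < \<alpha>\<close> by (simp add: a_def)
  have run_le: "(\<Sum>k<n. measure Q {y. running k y}) \<le> enn2real N" for n
  proof -
    have "ennreal (\<Sum>k<n. measure Q {y. running k y}) = (\<Sum>k<n. emeasure Q {y. running k y})"
      by (simp add: Q.emeasure_eq_measure sum_ennreal)
    also have "\<dots> = (\<integral>\<^sup>+y. (\<Sum>k<n. indicator {y. running k y} y) \<partial>Q)"
      using adapted_sets(1)[OF adapted_running] by (subst nn_integral_sum) auto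
    also have "\<dots> \<le> N"
      unfolding N_def by (intro nn_integral_mono sum_running_le_stop_time)
    finally show ?thesis
      using \<open>N \<noteq> \<infinity>\<close>
      by (metis enn2real_mono enn2real_ennreal infinity_ennreal_def less_top measure_nonneg sum_nonneg)
  qed
  have "a * (\<Sum>k<n. measure Q {y. stops d k y}) - 2 \<le> info * enn2real N" for n
  proof -
    have "a * (\<Sum>k<n. measure Q {y. stops d k y}) - 2 \<le> info * (\<Sum>k<n. measure Q {y. running k y})"
      using finite_horizon_bound[OF \<open>0 \<le> a\<close>, where n = n and d = d] exp_a by (simp add: \<alpha>_def decides_iff)
    also have "\<dots> \<le> info * enn2real N"
      using run_le \<open>0 \<le> info\<close> by (intro mult_left_mono)
    finally show ?thesis .
  qed
  moreover have "(\<lambda>n. a * (\<Sum>k<n. measure Q {y. stops d k y}) - 2)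
      \<longlonglongrightarrow> a * measure Q {y. \<exists>k. stops d k y} - 2"
    using stops_sums[OF Q.finite_measure_axioms sets_obs_law(1), of d]
    by (intro tendsto_intros) (simp add: sums_def)
  ultimately have bound: "a * measure Q {y. decides s f (curry y) d} - 2 \<le> info * enn2real N"
    unfolding decides_iff by (intro LIMSEQ_le_const2) auto
  have dec: "{y. decides s f (curry y) e} \<in> sets Q" for e
    using decides_measurable[of e] by (simp add: sets_obs_law pred_def space_PiM)
  have "AE y in Q. stop_time s f (curry y) \<noteq> \<infinity>"
    using \<open>N \<noteq> \<infinity>\<close> unfolding N_def
    by (intro nn_integral_PInf_AE) (auto cong: measurable_cong_sets simp: sets_obs_law)
  then have "AE y in Q. y \<in> {y. decides s f (curry y) d} \<union> {y. decides s f (curry y) (\<not> d)}"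
    by eventually_elim (use decides_of_finite_stop_time in auto)
  then have "1 = measure Q ({y. decides s f (curry y) d} \<union> {y. decides s f (curry y) (\<not> d)})"
    using dec by (subst Q.prob_eq_1[THEN iffD2]) auto
  also have "\<dots> \<le> measure Q {y. decides s f (curry y) d} + \<beta>"
    unfolding \<beta>_def using dec by (intro measure_Un_le) auto
  finally have "a * (1 - \<beta>) \<le> a * measure Q {y. decides s f (curry y) d}"
    using \<open>0 \<le> a\<close> by (intro mult_left_mono) auto
  then show ?thesis using bound by (simp add: a_def[symmetric] mult.commute)
qed

end

section \<open>Observations under the flip attack\<close>

text \<open>\<open>exp (h x)\<close> recovers the Radon-Nikodym derivative wherever that is positive
  and finite, which is almost everywhere by mutual absolute continuity.\<close>

lemma density_exp_log_RN_deriv: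
  fixes \<mu> \<nu> :: "'a measure"
  assumes "prob_space \<mu>" "prob_space \<nu>" and sets: "sets \<mu> = sets \<nu>"
    and "absolutely_continuous \<mu> \<nu>" "absolutely_continuous \<nu> \<mu>"
  defines "h \<equiv> \<lambda>x. ln (enn2real (RN_deriv \<nu> \<mu> x))"
  shows "\<mu> = density \<nu> (\<lambda>x. ennreal (exp (h x)))"
    and "\<nu> = density \<mu> (\<lambda>x. ennreal (exp (- h x)))"
proof -
  interpret \<mu>: prob_space \<mu> by fact
  interpret \<nu>: prob_space \<nu> by fact
  have h [measurable]: "h \<in> borel_measurable \<nu>" unfolding h_def by measurable
  have \<mu>_eq: "density \<nu> (RN_deriv \<nu> \<mu>) = \<mu>"
    by (rule \<nu>.density_RN_deriv) (use assms in auto)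
  \<comment> \<open>Where the derivative vanishes, \<mu> has no mass; absolute continuity transfers
    this to \<nu>.\<close>
  have "AE x in density \<nu> (RN_deriv \<nu> \<mu>). 0 < RN_deriv \<nu> \<mu> x"
    by (subst AE_density) auto
  then have "AE x in \<mu>. 0 < RN_deriv \<nu> \<mu> x" unfolding \<mu>_eq .
  then have pos: "AE x in \<nu>. 0 < RN_deriv \<nu> \<mu> x"
    using assms by (intro absolutely_continuous_AE[of \<nu> \<mu>]) auto
  have fin: "AE x in \<nu>. RN_deriv \<nu> \<mu> x \<noteq> \<infinity>"
    by (rule \<nu>.RN_deriv_finite) (use assms in \<open>auto intro: prob_space_imp_sigma_finite\<close>)
  have "AE x in \<nu>. RN_deriv \<nu> \<mu> x = ennreal (exp (h x))"
    using pos fin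
    by eventually_elim (simp add: h_def enn2real_positive_iff less_top)
  then have "density \<nu> (RN_deriv \<nu> \<mu>) = density \<nu> (\<lambda>x. ennreal (exp (h x)))"
    by (intro density_cong) auto
  then show 1: "\<mu> = density \<nu> (\<lambda>x. ennreal (exp (h x)))" by (simp add: \<mu>_eq)
  have "density \<mu> (\<lambda>x. ennreal (exp (- h x)))
      = density \<nu> (\<lambda>x. ennreal (exp (h x)) * ennreal (exp (- h x)))"
    by (subst 1) (simp add: density_density_eq)
  also have "\<dots> = density \<nu> (\<lambda>x. 1)"
    by (simp add: ennreal_mult[symmetric] exp_add[symmetric])
  finally show "\<nu> = density \<mu> (\<lambda>x. ennreal (exp (- h x)))" by (simp add: density_1)
qed

definition flipped :: "nat \<Rightarrow> nat \<Rightarrow> bool \<Rightarrow> nat \<Rightarrow> bool" where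
  "flipped s c \<theta> i \<longleftrightarrow> (if \<theta> then i \<in> {s - c + 1..s} else i \<in> {1..c})"

text \<open>The law a sensor displays after the attack. A sensor displays \<nu> if it is honest in
  state 0 or flipped in state 1, which the equivalence merges into one test.\<close>

definition flip_law :: "real measure \<Rightarrow> real measure \<Rightarrow> nat \<Rightarrow> nat \<Rightarrow> bool \<Rightarrow> nat \<Rightarrow> real measure" where
  "flip_law \<mu> \<nu> s c \<theta> i = (if flipped s c \<theta> i \<longleftrightarrow> \<theta> then \<nu> else \<mu>)"

text \<open>The true observation cancels, so the attack merely selects which coordinate of
  \<open>w\<close> is shown.\<close>

lemma manipulated_eq: "manipulated s c \<theta> w k i = w (k, i, flipped s c \<theta> i)"
  by (auto simp: manipulated_def flip_attack_def true_obs_def flipped_def)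

text \<open>Selecting coordinates of a product measure along the injective map \<open>t\<close>
  gives the product of the selected marginals.\<close>

lemma distr_manipulated:
  assumes "prob_space \<mu>" "prob_space \<nu>"
  shows "distr (sample_space \<mu> \<nu> \<theta>) (obs_law (flip_law \<mu> \<nu> s c \<theta>))
      (\<lambda>w j. manipulated s c \<theta> w (fst j) (snd j)) = obs_law (flip_law \<mu> \<nu> s c \<theta>)"
    and "(\<lambda>w j. manipulated s c \<theta> w (fst j) (snd j))
      \<in> measurable (sample_space \<mu> \<nu> \<theta>) (obs_law (flip_law \<mu> \<nu> s c \<theta>))"
proof -
  define M where "M = (\<lambda>(k::nat, i::nat, b). if b then (if \<theta> then \<nu> else \<mu>) else (if \<theta> then \<mu> else \<nu>))"
  define t where "t = (\<lambda>j :: nat \<times> nat. (fst j, snd j, flipped s c \<theta> (snd j)))"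
  have law: "flip_law \<mu> \<nu> s c \<theta> (snd j) = M (t j)" for j
    by (auto simp: flip_law_def M_def t_def)
  have map: "(\<lambda>w j. manipulated s c \<theta> w (fst j) (snd j)) = (\<lambda>w. \<lambda>j\<in>UNIV. w (t j))"
    by (simp add: manipulated_eq t_def fun_eq_iff)
  have "distr (PiM UNIV M) (PiM UNIV (\<lambda>j. M (t j))) (\<lambda>w. \<lambda>j\<in>UNIV. w (t j)) = PiM UNIV (\<lambda>j. M (t j))"
    by (rule distr_PiM_reindex) (auto simp: assms M_def t_def inj_on_def prod_eq_iff split: prod.splits)
  then show "distr (sample_space \<mu> \<nu> \<theta>) (obs_law (flip_law \<mu> \<nu> s c \<theta>))
      (\<lambda>w j. manipulated s c \<theta> w (fst j) (snd j)) = obs_law (flip_law \<mu> \<nu> s c \<theta>)"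
    unfolding sample_space_def obs_law_def law map M_def[symmetric] .
  have "(\<lambda>w. \<lambda>j\<in>UNIV. w (t j)) \<in> measurable (PiM UNIV M) (PiM UNIV (\<lambda>j. M (t j)))"
    by (intro measurable_restrict measurable_component_singleton) simp
  then show "(\<lambda>w j. manipulated s c \<theta> w (fst j) (snd j))
      \<in> measurable (sample_space \<mu> \<nu> \<theta>) (obs_law (flip_law \<mu> \<nu> s c \<theta>))"
    unfolding sample_space_def obs_law_def law map M_def[symmetric] .
qed

lemma curry_manipulated:
  "curry (\<lambda>j. manipulated s c \<theta> w (fst j) (snd j)) = manipulated s c \<theta> w"
  by (simp add: curry_def)

text \<open>The trade-off with state \<theta> as the truth and its negation as the rival;
  \<open>J\<close> is the information that the \<open>s - 2 * c\<close> sensors outside both blocks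
  carry in one time step.\<close>

lemma flip_delay_bound:
  fixes \<mu> \<nu> :: "real measure" and s c :: nat and \<theta> :: bool
    and f :: "nat \<Rightarrow> (nat \<times> nat \<Rightarrow> real) \<Rightarrow> decision"
  assumes prob: "prob_space \<mu>" "prob_space \<nu>"
    and sets: "sets \<mu> = sets borel" "sets \<nu> = sets borel"
    and ac: "absolutely_continuous \<mu> \<nu>" "absolutely_continuous \<nu> \<mu>"
    and int: "integrable \<mu> (\<lambda>x. ln (enn2real (RN_deriv \<nu> \<mu> x)))"
      "integrable \<nu> (\<lambda>x. ln (enn2real (RN_deriv \<nu> \<mu> x)))"
    and "s > 2 * c" and strategy: "detection_strategy s f"
    and eq: "flip_alpha \<mu> \<nu> s c f = flip_beta \<mu> \<nu> s c f"
    and pos: "flip_alpha \<mu> \<nu> s c f > 0"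
    and fin: "flip_delay \<mu> \<nu> s c f \<noteq> \<infinity>"
  defines "J \<equiv> (real s - 2 * real c) * (if \<theta> then info1 \<mu> \<nu> else info0 \<mu> \<nu>)"
  assumes "0 \<le> J"
  shows "(1 - flip_alpha \<mu> \<nu> s c f) * ln (1 / flip_alpha \<mu> \<nu> s c f) - 2
    \<le> J * enn2real (flip_delay \<mu> \<nu> s c f)"
proof -
  define h where "h = (\<lambda>x. ln (enn2real (RN_deriv \<nu> \<mu> x)))"
  \<comment> \<open>Sensors in either block display the same law in both states, so their ratio is
    0. On the others the sign of \<open>h\<close> follows the true state.\<close>
  define l where "l = (\<lambda>i. if i \<in> {1..c} \<union> {s - c + 1..s} then (\<lambda>x. 0)
    else if \<theta> then h else (\<lambda>x. - h x))"
  let ?law = "flip_law \<mu> \<nu> s c"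
  have dens: "density \<nu> (\<lambda>x. ennreal (exp (h x))) = \<mu>"
    "density \<mu> (\<lambda>x. ennreal (exp (- h x))) = \<nu>"
    unfolding h_def
    by (rule density_exp_log_RN_deriv[OF prob _ ac, symmetric]; simp add: sets)+
  have [measurable]: "h \<in> borel_measurable borel"
    using int(1)[folded h_def] measurable_cong_sets[OF sets(1) refl] by auto
  have test: "sequential_test (?law \<theta>) (?law (\<not> \<theta>)) l s f"
  proof (rule sequential_test.intro)
    fix i
    show "prob_space (?law \<theta> i)" "prob_space (?law (\<not> \<theta>) i)" "sets (?law \<theta> i) = sets borel"
      using prob sets by (auto simp: flip_law_def)
    show "l i \<in> borel_measurable borel" by (auto simp: l_def)
    show "integrable (?law \<theta> i) (l i)"
      using int prob by (auto simp: l_def flip_law_def h_def)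
    show "?law (\<not> \<theta>) i = density (?law \<theta> i) (\<lambda>x. ennreal (exp (- l i x)))"
    proof (cases "i \<in> {1..c} \<union> {s - c + 1..s}")
      case True
      \<comment> \<open>\<open>s > 2 * c\<close> keeps the two blocks disjoint, so no sensor is
        flipped in both states.\<close>
      then have "?law (\<not> \<theta>) i = ?law \<theta> i"
        using \<open>s > 2 * c\<close> by (auto simp: flip_law_def flipped_def)
      with True show ?thesis by (simp add: l_def density_1)
    next
      case False
      then show ?thesis
        by (auto simp: l_def flip_law_def flipped_def dens)
    qed
  qed (rule strategy)
  interpret sequential_test "?law \<theta>" "?law (\<not> \<theta>)" l s f by (rule test)
  have info: "info = J"
  proof -
    have "info = (\<Sum>i=1..s. if i \<in> {c + 1..s - c} then (if \<theta> then info1 \<mu> \<nu> else info0 \<mu> \<nu>) else 0)"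
      unfolding info_def
      by (intro sum.cong refl)
        (auto simp: l_def flip_law_def flipped_def info0_def info1_def h_def)
    also have "\<dots> = (\<Sum>i\<in>{1..s} \<inter> {c + 1..s - c}. if \<theta> then info1 \<mu> \<nu> else info0 \<mu> \<nu>)"
      by (rule sum.inter_restrict[symmetric]) simp
    also have "{1..s} \<inter> {c + 1..s - c} = {c + 1..s - c}" by auto
    also have "(\<Sum>i\<in>{c + 1..s - c}. if \<theta> then info1 \<mu> \<nu> else info0 \<mu> \<nu>) = J"
      using \<open>s > 2 * c\<close> by (simp add: J_def of_nat_diff)
    finally show ?thesis .
  qed
  have sets_law: "sets (obs_law (?law e)) = sets (PiM UNIV (\<lambda>_. borel))" for e
    using sets_obs_law by (cases "e = \<theta>") auto
  have prob_eq: "flip_decision_prob \<mu> \<nu> s c f e d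
      = measure (obs_law (?law e)) {y. decides s f (curry y) d}" for e d
  proof -
    have "{y. decides s f (curry y) d} \<in> sets (obs_law (?law e))"
      using decides_measurable[of d] by (simp add: sets_law pred_def space_PiM)
    then have "measure (distr (sample_space \<mu> \<nu> e) (obs_law (?law e))
        (\<lambda>w j. manipulated s c e w (fst j) (snd j))) {y. decides s f (curry y) d}
      = flip_decision_prob \<mu> \<nu> s c f e d"
      by (subst measure_distr[OF distr_manipulated(2)[OF prob]])
        (auto simp: flip_decision_prob_def curry_manipulated intro!: arg_cong[where f = "measure _"])
    then show ?thesis by (simp add: distr_manipulated(1)[OF prob])
  qed
  define N where "N = (\<integral>\<^sup>+y. stop_time s f (curry y) \<partial>obs_law (?law \<theta>))"
  have "N = (\<integral>\<^sup>+y. stop_time s f (curry y) \<partial>distr (sample_space \<mu> \<nu> \<theta>) (obs_law (?law \<theta>))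
      (\<lambda>w j. manipulated s c \<theta> w (fst j) (snd j)))"
    by (simp add: N_def distr_manipulated(1)[OF prob])
  also have "\<dots> = (\<integral>\<^sup>+w. stop_time s f (manipulated s c \<theta> w) \<partial>sample_space \<mu> \<nu> \<theta>)"
    using stop_time_measurable
    by (subst nn_integral_distr[OF distr_manipulated(2)[OF prob]])
      (simp_all add: curry_manipulated measurable_cong_sets[OF sets_law refl])
  finally have N_le: "N \<le> flip_delay \<mu> \<nu> s c f"
    by (cases \<theta>) (auto simp: flip_delay_def)
  then have "N \<noteq> \<infinity>" using fin by (auto simp: top_unique)
  \<comment> \<open>Which of the two errors is \<alpha> and which is \<beta> depends on \<theta>;
    their equality removes the distinction.\<close>
  have errors: "measure (obs_law (?law (\<not> \<theta>))) {y. decides s f (curry y) \<theta>} = flip_alpha \<mu> \<nu> s c f"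
    "measure (obs_law (?law \<theta>)) {y. decides s f (curry y) (\<not> \<theta>)} = flip_alpha \<mu> \<nu> s c f"
    using eq by (cases \<theta>; simp add: prob_eq[symmetric] flip_alpha_def flip_beta_def)+
  have "(1 - flip_alpha \<mu> \<nu> s c f) * ln (1 / flip_alpha \<mu> \<nu> s c f) - 2 \<le> J * enn2real N"
    using error_delay_tradeoff[of \<theta>] pos \<open>0 \<le> J\<close> \<open>N \<noteq> \<infinity>\<close>
    unfolding errors info N_def by blast
  also have "\<dots> \<le> J * enn2real (flip_delay \<mu> \<nu> s c f)"
    using N_le fin \<open>0 \<le> J\<close> by (intro mult_left_mono enn2real_mono) (auto simp: less_top)
  finally show ?thesis .
qed

section \<open>Passage to the limit of vanishing error\<close>

lemma rate_limit_le:
  fixes a :: "nat \<Rightarrow> real" and D :: "nat \<Rightarrow> ennreal" and \<gamma> :: ereal and J :: real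
  assumes pos: "\<And>n. 0 < a n" and lim: "a \<longlonglongrightarrow> 0" and "0 \<le> J"
    and bound: "\<And>n. D n \<noteq> \<infinity> \<Longrightarrow> (1 - a n) * ln (1 / a n) - 2 \<le> J * enn2real (D n)"
    and rate: "(\<lambda>n. ereal (ln (1 / a n)) / enn2ereal (D n)) \<longlonglongrightarrow> \<gamma>"
  shows "\<gamma> \<le> ereal J"
proof -
  \<comment> \<open>The left side of \<open>bound\<close> divided by \<open>ln (1 / a n)\<close>. It
    tends to 1, so the rate is eventually at most \<open>J / v n\<close>.\<close>
  define v where "v = (\<lambda>n. (1 - a n) - 2 / ln (1 / a n))"
  have a_right: "filterlim a (at_right 0) sequentially"
    using lim pos by (simp add: filterlim_at less_imp_neq[OF pos, symmetric])
  have "filterlim (\<lambda>n. - ln (a n)) at_top sequentially"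
    using filterlim_compose[OF ln_at_0 a_right] by (simp add: filterlim_uminus_at_bot)
  moreover have ln_inv: "ln (1 / a n) = - ln (a n)" for n
    using pos[of n] by (simp add: ln_div)
  ultimately have ln_top: "filterlim (\<lambda>n. ln (1 / a n)) at_top sequentially" by simp
  have "v \<longlonglongrightarrow> (1 - 0) - 0"
    unfolding v_def
    by (intro tendsto_diff tendsto_const lim tendsto_divide_0[OF tendsto_const]
        filterlim_at_top_imp_at_infinity ln_top)
  then have v: "v \<longlonglongrightarrow> 1" by simp
  then have "(\<lambda>n. J / v n) \<longlonglongrightarrow> J / 1" by (intro tendsto_intros) auto
  then have "(\<lambda>n. ereal (J / v n)) \<longlonglongrightarrow> ereal J" by simp
  moreover have "\<forall>\<^sub>F n in sequentially. ereal (ln (1 / a n)) / enn2ereal (D n) \<le> ereal (J / v n)"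
  proof -
    have "\<forall>\<^sub>F n in sequentially. 0 < v n" using v by (rule order_tendstoD) simp
    moreover have "\<forall>\<^sub>F n in sequentially. 0 < ln (1 / a n)"
      using ln_top by (simp add: filterlim_at_top_dense)
    ultimately show ?thesis
    proof eventually_elim
      case (elim n)
      show ?case
      proof (cases "D n = \<infinity>")
        \<comment> \<open>An infinite delay makes the quotient 0 in \<open>ereal\<close>.\<close>
        case True
        then show ?thesis using elim \<open>0 \<le> J\<close> by simp
      next
        case False
        have "v n * ln (1 / a n) = (1 - a n) * ln (1 / a n) - 2"
          using elim by (simp add: v_def left_diff_distrib)
        also note bound[OF False]
        finally have le: "v n * ln (1 / a n) \<le> J * enn2real (D n)" .
        \<comment> \<open>Positivity here rules out zero delay, for which the quotient would be
          infinite.\<close>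
        have "0 < v n * ln (1 / a n)" using elim by simp
        then have "0 < enn2real (D n)" using le \<open>0 \<le> J\<close>
          by (metis enn2real_nonneg less_eq_real_def mult_zero_right not_le)
        moreover have "enn2ereal (D n) = ereal (enn2real (D n))"
          using False by (cases "D n") auto
        ultimately show ?thesis using le elim by (simp add: field_simps)
      qed
    qed
  qed
  ultimately show ?thesis using rate by (intro tendsto_le[OF _ _ rate]) auto
qed

theorem theorem1:
  fixes \<mu> \<nu> :: "real measure" and s c :: nat
    and F :: "nat \<Rightarrow> nat \<Rightarrow> (nat \<times> nat \<Rightarrow> real) \<Rightarrow> decision"
    and \<gamma> :: ereal
  assumes "prob_space \<mu>" and "prob_space \<nu>"
    and "sets \<mu> = sets borel" and "sets \<nu> = sets borel"
    and "absolutely_continuous \<mu> \<nu>" and "absolutely_continuous \<nu> \<mu>"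
    and "integrable \<mu> (\<lambda>x. ln (enn2real (RN_deriv \<nu> \<mu> x)))"
    and "integrable \<nu> (\<lambda>x. ln (enn2real (RN_deriv \<nu> \<mu> x)))"
    and "info0 \<mu> \<nu> > 0" and "info1 \<mu> \<nu> > 0"
    and "s > 2 * c"
    and "\<And>n. detection_strategy s (F n)"
    and "\<And>n. flip_alpha \<mu> \<nu> s c (F n) = flip_beta \<mu> \<nu> s c (F n)"
    and "\<And>n. flip_alpha \<mu> \<nu> s c (F n) > 0"
    and "(\<lambda>n. flip_alpha \<mu> \<nu> s c (F n)) \<longlonglongrightarrow> 0"
    and "(\<lambda>n. ereal (ln (1 / flip_alpha \<mu> \<nu> s c (F n))) / enn2ereal (flip_delay \<mu> \<nu> s c (F n)))
           \<longlonglongrightarrow> \<gamma>"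
  shows "\<gamma> \<le> ereal ((real s - 2 * real c) * min (info0 \<mu> \<nu>) (info1 \<mu> \<nu>))"
proof -
  have "0 < real s - 2 * real c" using \<open>s > 2 * c\<close> by linarith
  then have nonneg: "0 \<le> (real s - 2 * real c) * (if \<theta> then info1 \<mu> \<nu> else info0 \<mu> \<nu>)" for \<theta>
    using assms(9,10) by simp
  \<comment> \<open>The delay is the larger of the two expectations, so the bound holds for each
    state and therefore for the minimum.\<close>
  have "\<gamma> \<le> ereal ((real s - 2 * real c) * (if \<theta> then info1 \<mu> \<nu> else info0 \<mu> \<nu>))" for \<theta>
  proof (rule rate_limit_le[OF assms(14,15) nonneg _ assms(16)])
    fix n assume "flip_delay \<mu> \<nu> s c (F n) \<noteq> \<infinity>"
    then show "(1 - flip_alpha \<mu> \<nu> s c (F n)) * ln (1 / flip_alpha \<mu> \<nu> s c (F n)) - 2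
      \<le> (real s - 2 * real c) * (if \<theta> then info1 \<mu> \<nu> else info0 \<mu> \<nu>)
        * enn2real (flip_delay \<mu> \<nu> s c (F n))"
      by (rule flip_delay_bound[OF assms(1-8) assms(11) assms(12-14) _ nonneg])
  qed
  from this[of False] this[of True] show ?thesis by (simp add: min_def)
qed

end
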